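(* Fix a tree partition of $\omega$ with associated ideals $\mathcal H_n$ and $\mathcal H_{<\omega}=\bigcup_n\mathcal H_n$. Let $K\ge2$ and let $(\xi_K,\dots,\xi_1)$ be the canonical fragment of length $K$. Then: (a) every graph test of $(\xi_2,\xi_1)$ lies in $\mathcal H_{K-1}$, i.e. $\{x:\xi_1(x)\le h(\xi_2(x))\}\in\mathcal H_{K-1}$ for every $h:\omega\to\omega$; (b) the essential depth of $\xi_2$ is $\delta(\xi_2)=K-1$; consequently $K-1$ is the least $m\geq 1$ such that all graph tests of $(\xi_2,\xi_1)$ lie in $\mathcal H_m$. Hence, with $m=K-1$, the pair $(\xi_2,\xi_1)$ extends to a coherent window of length $m+1=K$ (namely the canonical fragment itself), but not to a coherent window of length $m+2$. (A coherent window of length $N$ extending $(\xi_2,\xi_1)$ is a sequence of functions $(\xi_N,\dots,\xi_2,\xi_1)$ from $\omega$ to $\omega$ such that for every $k\le N$ the map $(\xi_k,\dots,\xi_1):\omega\to\omega^k$ witnesses $\mathrm{Fin}^{\otimes k}\le_K\mathcal H_{<\omega}$.)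
   Context: A tree partition of $\omega$ is a family $\langle A_s:s\in\omega^{<\omega}\rangle$ of infinite subsets of $\omega$ such that $A_\varnothing=\omega$, for each $s$ the family $\{A_{s^\frown n}:n\in\omega\}$ is a partition of $A_s$, and any two distinct points of $\omega$ lie in different cells $A_s\neq A_t$ with $|s|=|t|=n$ for some $n$. For $x\in\omega$, $b_x\in\omega^\omega$ is the unique branch with $x\in A_{b_x\upharpoonright n}$ for all $n$. For $X\subseteq\omega$ let $T^\infty_X=\{s\in\omega^{<\omega}:X\cap A_s\text{ is infinite}\}$. For $T\subseteq\omega^{<\omega}$ put $\mathrm{Succ}_T(s)=\{n:s^\frown n\in T\}$ and $D(T)=\{s\in T:\mathrm{Succ}_T(s)\text{ is infinite}\}$; $D^0(T)=T$, $D^{n+1}(T)=D(D^n(T))$. For $n<\omega$, $\mathcal H_n=\{X\subseteq\omega:\varnothing\notin D^n(T^\infty_X)\}$ (an ideal on $\omega$). $\mathrm{Fin}$ is the ideal of finite subsets of $\omega$; $\mathrm{Fin}^{\otimes1}=\mathrm{Fin}$, and $\mathrm{Fin}^{\otimes(k+1)}$ is the ideal on $\omega^{k+1}$ of all $C$ such that for all but finitely many $n$ the section $\{t\in\omega^k:(n)^\frown t\in C\}$ belongs to $\mathrm{Fin}^{\otimes k}$. A map $q:\omega\to\omega^k$ witnesses $\mathrm{Fin}^{\otimes k}\le_K\mathcal H_{<\omega}$ if $q^{-1}[B]\in\mathcal H_{<\omega}$ for every $B\in\mathrm{Fin}^{\otimes k}$. Canonical fragment of length $K$: fix bijections $e_u:A_u\to\omega$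 for $u\in\omega^{K-1}$; put $\xi_j(x)=b_x(K-j)$ for $2\le j\le K$ and $\xi_1(x)=e_{b_x\upharpoonright(K-1)}(x)$. Essential depth: for $\varphi:\omega\to\omega$, $\delta(\varphi)$ is the least $d\ge1$ such that there is $Z\in\mathcal H_{<\omega}$ with $\varphi[A_s\setminus Z]$ finite for every $s\in\omega^d$ ($\delta(\varphi)=\infty$ if there is no such $d$). *)

theory Defs
  imports Main "HOL-Library.Disjoint_Sets" "HOL-Library.Extended_Nat"
begin

text \<open>
  Finite sequences of natural numbers are lists, the \<open>k\<close>-th power of omega is the set of lists of
  length \<open>k\<close>, and the extension of \<open>s\<close> by the new last entry \<open>n\<close> is \<open>s @ [n]\<close>.
\<close>

definition seqs :: "nat \<Rightarrow> nat list set" where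
  "seqs k = {s. length s = k}"

definition tree_partition :: "(nat list \<Rightarrow> nat set) \<Rightarrow> bool" where
  "tree_partition A \<longleftrightarrow>
     (\<forall>s. infinite (A s)) \<and>
     A [] = UNIV \<and>
     (\<forall>s. disjoint_family (\<lambda>n. A (s @ [n])) \<and> (\<Union>n. A (s @ [n])) = A s) \<and>
     (\<forall>x y. x \<noteq> y \<longrightarrow>
        (\<exists>n. \<exists>s\<in>seqs n. \<exists>t\<in>seqs n. x \<in> A s \<and> y \<in> A t \<and> A s \<noteq> A t))"

definition restr :: "(nat \<Rightarrow> nat) \<Rightarrow> nat \<Rightarrow> nat list" where
  "restr b n = map b [0..<n]"

definition branch :: "(nat list \<Rightarrow> nat set) \<Rightarrow> nat \<Rightarrow> nat \<Rightarrow> nat" where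
  "branch A x = (THE b. \<forall>n. x \<in> A (restr b n))"

lemma restr_Suc: "restr b (Suc n) = restr b n @ [b n]"
  by (simp add: restr_def)

lemma branch_ex1:
  assumes "tree_partition A"
  shows "\<exists>!b. \<forall>n. x \<in> A (restr b n)"
proof -
  have root: "A [] = UNIV"
    and un: "\<And>s. (\<Union>n. A (s @ [n])) = A s"
    and disj: "\<And>s. disjoint_family (\<lambda>n. A (s @ [n]))"
    using assms by (auto simp: tree_partition_def)
  define nxt where "nxt s = (SOME n. x \<in> A (s @ [n]))" for s
  define path where "path = rec_nat [] (\<lambda>_ s. s @ [nxt s])"
  define b where "b n = nxt (path n)" for n
  have nxt: "x \<in> A (s @ [nxt s])" if "x \<in> A s" for s
    using that un[of s] unfolding nxt_def by (auto intro: someI)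
  have "restr b n = path n \<and> x \<in> A (path n)" for n
  proof (induction n)
    case 0
    then show ?case by (simp add: restr_def path_def root)
  next
    case (Suc n)
    moreover have "path (Suc n) = path n @ [b n]" by (simp add: path_def b_def)
    ultimately show ?case using nxt[of "path n"] by (simp add: restr_Suc b_def)
  qed
  then have ex: "\<forall>n. x \<in> A (restr b n)" by simp
  show ?thesis
  proof (rule ex1I[of _ b], rule ex)
    fix c assume c: "\<forall>n. x \<in> A (restr c n)"
    have "c n = b n" if "restr c n = restr b n" for n
    proof (rule ccontr)
      assume "c n \<noteq> b n"
      then have "A (restr b n @ [c n]) \<inter> A (restr b n @ [b n]) = {}"
        using disj[of "restr b n"] by (auto simp: disjoint_family_on_def)
      moreover have "x \<in> A (restr b n @ [c n])" "x \<in> A (restr b n @ [b n])"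
        using c[rule_format, of "Suc n"] ex[rule_format, of "Suc n"] that
        by (simp_all add: restr_Suc)
      ultimately show False by blast
    qed
    moreover from this have "restr c n = restr b n" for n
      by (induction n) (simp add: restr_def, simp add: restr_Suc)
    ultimately show "c = b" by blast
  qed
qed

definition inf_tree :: "(nat list \<Rightarrow> nat set) \<Rightarrow> nat set \<Rightarrow> nat list set" where
  "inf_tree A X = {s. infinite (X \<inter> A s)}"

definition Succ :: "nat list set \<Rightarrow> nat list \<Rightarrow> nat set" where
  "Succ T s = {n. s @ [n] \<in> T}"

definition deriv_tree :: "nat list set \<Rightarrow> nat list set" where
  "deriv_tree T = {s \<in> T. infinite (Succ T s)}"

definition H :: "(nat list \<Rightarrow> nat set) \<Rightarrow> nat \<Rightarrow> nat set set" where
  "H A n = {X. [] \<notin> (deriv_tree ^^ n) (inf_tree A X)}"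

definition H_fin :: "(nat list \<Rightarrow> nat set) \<Rightarrow> nat set set" where
  "H_fin A = (\<Union>n. H A n)"

text \<open>The tensor powers of Fin are meaningful for positive exponents; the value at \<open>0\<close> is a
  convention that is never used below.\<close>

fun Fin_power :: "nat \<Rightarrow> nat list set set" where
  "Fin_power 0 = {{}}"
| "Fin_power (Suc 0) = {C. C \<subseteq> seqs 1 \<and> finite C}"
| "Fin_power (Suc (Suc k)) =
     {C. C \<subseteq> seqs (Suc (Suc k)) \<and>
         finite {n. {t \<in> seqs (Suc k). n # t \<in> C} \<notin> Fin_power (Suc k)}}"

definition katetov_witness :: "(nat list \<Rightarrow> nat set) \<Rightarrow> nat \<Rightarrow> (nat \<Rightarrow> nat list) \<Rightarrow> bool" where
  "katetov_witness A k q \<longleftrightarrow>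
     range q \<subseteq> seqs k \<and> (\<forall>B\<in>Fin_power k. q -` B \<in> H_fin A)"

text \<open>A finite sequence of functions with indices \<open>N, \<dots>, 1\<close> is given by an indexed family \<open>\<xi>\<close>, of
  which only the members \<open>\<xi> 1, \<dots>, \<xi> N\<close> matter. The tuple map lists them by decreasing index.\<close>

definition tuple_map :: "(nat \<Rightarrow> nat \<Rightarrow> nat) \<Rightarrow> nat \<Rightarrow> nat \<Rightarrow> nat list" where
  "tuple_map \<xi> k x = map (\<lambda>j. \<xi> j x) (rev [1..<Suc k])"

definition coherent_window_extending ::
  "(nat list \<Rightarrow> nat set) \<Rightarrow> nat \<Rightarrow> (nat \<Rightarrow> nat) \<Rightarrow> (nat \<Rightarrow> nat) \<Rightarrow> (nat \<Rightarrow> nat \<Rightarrow> nat) \<Rightarrow> bool" where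
  "coherent_window_extending A N \<phi> \<psi> \<xi> \<longleftrightarrow>
     N \<ge> 2 \<and> \<xi> 2 = \<phi> \<and> \<xi> 1 = \<psi> \<and>
     (\<forall>k. 1 \<le> k \<and> k \<le> N \<longrightarrow> katetov_witness A k (tuple_map \<xi> k))"

definition canonical_fragment ::
  "(nat list \<Rightarrow> nat set) \<Rightarrow> nat \<Rightarrow> (nat list \<Rightarrow> nat \<Rightarrow> nat) \<Rightarrow> nat \<Rightarrow> nat \<Rightarrow> nat" where
  "canonical_fragment A K e j x =
     (if j = 1 then e (restr (branch A x) (K - 1)) x else branch A x (K - j))"

definition graph_test :: "(nat \<Rightarrow> nat) \<Rightarrow> (nat \<Rightarrow> nat) \<Rightarrow> (nat \<Rightarrow> nat) \<Rightarrow> nat set" where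
  "graph_test \<phi> \<psi> h = {x. \<psi> x \<le> h (\<phi> x)}"

definition depth_bound :: "(nat list \<Rightarrow> nat set) \<Rightarrow> (nat \<Rightarrow> nat) \<Rightarrow> nat \<Rightarrow> bool" where
  "depth_bound A \<phi> d \<longleftrightarrow>
     d \<ge> 1 \<and> (\<exists>Z\<in>H_fin A. \<forall>s\<in>seqs d. finite (\<phi> ` (A s - Z)))"

definition essential_depth :: "(nat list \<Rightarrow> nat set) \<Rightarrow> (nat \<Rightarrow> nat) \<Rightarrow> enat" where
  "essential_depth A \<phi> =
     (if \<exists>d. depth_bound A \<phi> d then enat (LEAST d. depth_bound A \<phi> d) else \<infinity>)"

end

theory Submission
  imports Defs
begin

text \<open>
  Call a set \<open>X\<close> positive of rank \<open>0\<close> at a node \<open>s\<close> if it meets the cell \<open>A s\<close> in an infinite set,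
  and positive of rank \<open>Suc n\<close> at \<open>s\<close> if it is positive of rank \<open>n\<close> at infinitely many children of
  \<open>s\<close>. This is membership of \<open>s\<close> in the \<open>n\<close>-th derivative of the tree of \<open>X\<close>
  (\<open>mem_deriv_tree_iff_positive\<close>), so \<open>H A n\<close> consists of the sets that are not positive of rank
  \<open>n\<close> at the root. Unfolding the first \<open>m\<close> levels gives the bridge \<open>positive_add_iff\<close>: \<open>X\<close> is
  positive of rank \<open>m + r\<close> at \<open>s\<close> iff the nodes that extend \<open>s\<close> by \<open>m\<close> entries and at which
  it is positive of rank \<open>r\<close> form a set outside the \<open>m\<close>-th power of Fin. Sets in a power of Fin
  are called small.

  Put \<open>m = K - 1\<close>. On a cell of level \<open>m\<close> the function \<open>\<xi> 2\<close> is constant and \<open>\<xi> 1\<close> is a bijection.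
  Hence a graph test meets each such cell in a finite set and lies in \<open>H A m\<close>, the depth of \<open>\<xi> 2\<close> is
  at most \<open>m\<close>, and, up to the identification of a cell of level \<open>m\<close> with the natural numbers,
  the canonical fragment is the coordinate map, which makes it a coherent window. The
  lower bounds hold because \<open>\<xi> 2\<close> is still free on a cell of level less than \<open>m\<close>: the zero set
  of \<open>\<xi> 1\<close> is infinite in each such cell, and if \<open>\<xi> 2\<close> takes only finitely many values outside
  of \<open>Z\<close> on each cell of some level less than \<open>m\<close>, then \<open>Z\<close> contains the cells of almost all
  children of each node of level \<open>m - 1\<close>, so it is positive of every rank.

  For the failure of a longer window, let \<open>q\<close> be the map into sequences of length \<open>m + 1\<close> left
  after dropping the last function \<open>\<xi> 1\<close>. Its last entry is constant on each cell \<open>A u\<close> of level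
  \<open>m\<close>. Testing \<open>q\<close> against one suitable set of the \<open>m + 1\<close>-st power of Fin shows
  that, off a set \<open>Z\<close> in the ideal, \<open>q\<close> has finitely many values on each \<open>A u\<close>; so for almost all
  \<open>u\<close> some value \<open>f u\<close> is taken on a set of large rank at \<open>u\<close>. Then \<open>f\<close> would
  be a Katetov reduction of the \<open>m + 1\<close>-st power of Fin to the \<open>m\<close>-th one, and
  \<open>no_Katetov_reduction_Fin_power_Suc\<close> excludes this.
\<close>

section \<open>Tensor powers of Fin\<close>

lemma Cons_mem_seqs [simp]: "n # t \<in> seqs (Suc k) \<longleftrightarrow> t \<in> seqs k"
  by (simp add: seqs_def)

text \<open>The exponent one fits the recursion because the power with exponent zero is the ideal on a
  one-point set that contains only the empty set.\<close>

lemma Fin_power_Suc_iff: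
  "C \<in> Fin_power (Suc k) \<longleftrightarrow>
     C \<subseteq> seqs (Suc k) \<and> finite {n. {t. n # t \<in> C} \<notin> Fin_power k}"
proof (cases k)
  case 0
  show ?thesis
  proof (cases "C \<subseteq> seqs 1")
    case True
    have C: "C = (\<lambda>n. [n]) ` {n. {t. n # t \<in> C} \<noteq> {}}"
    proof (intro equalityI subsetI)
      fix s assume "s \<in> C"
      moreover from this obtain n where "s = [n]"
        using True by (auto simp: seqs_def length_Suc_conv)
      ultimately show "s \<in> (\<lambda>n. [n]) ` {n. {t. n # t \<in> C} \<noteq> {}}" by auto
    next
      fix s assume "s \<in> (\<lambda>n. [n]) ` {n. {t. n # t \<in> C} \<noteq> {}}"
      then obtain n t where "s = [n]" "n # t \<in> C" by auto
      moreover from this have "t = []" using True by (auto simp: seqs_def)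
      ultimately show "s \<in> C" by simp
    qed
    have "finite C \<longleftrightarrow> finite {n. {t. n # t \<in> C} \<noteq> {}}"
      by (subst C, rule finite_image_iff) (simp add: inj_on_def)
    then show ?thesis using 0 by simp
  qed (use 0 in simp)
next
  case (Suc j)
  have "{t \<in> seqs k. n # t \<in> C} = {t. n # t \<in> C}" if "C \<subseteq> seqs (Suc k)" for n
    using that by auto
  then show ?thesis using Suc by (auto simp del: Cons_mem_seqs)
qed

lemma Fin_power_SucI:
  assumes "C \<subseteq> seqs (Suc k)" "finite N" "\<And>n. n \<notin> N \<Longrightarrow> {t. n # t \<in> C} \<in> Fin_power k"
  shows "C \<in> Fin_power (Suc k)"
proof -
  have "{n. {t. n # t \<in> C} \<notin> Fin_power k} \<subseteq> N" using assms(3) by blast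
  then show ?thesis using assms(1,2) by (simp add: Fin_power_Suc_iff finite_subset)
qed

lemma Fin_power_SucD:
  assumes "C \<in> Fin_power (Suc k)"
  shows "C \<subseteq> seqs (Suc k)" "finite {n. {t. n # t \<in> C} \<notin> Fin_power k}"
  using assms by (simp_all add: Fin_power_Suc_iff)

lemma empty_mem_Fin_power: "{} \<in> Fin_power k"
  by (induction k) (simp_all add: Fin_power_Suc_iff)

lemma Fin_power_subset: "C \<in> Fin_power k \<Longrightarrow> B \<subseteq> C \<Longrightarrow> B \<in> Fin_power k"
proof (induction k arbitrary: B C)
  case (Suc k)
  show ?case
  proof (rule Fin_power_SucI)
    show "B \<subseteq> seqs (Suc k)" using Fin_power_SucD(1)[OF Suc.prems(1)] Suc.prems(2) by simp
    show "finite {n. {t. n # t \<in> C} \<notin> Fin_power k}" by (rule Fin_power_SucD(2)[OF Suc.prems(1)])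
    show "{t. n # t \<in> B} \<in> Fin_power k" if "n \<notin> {n. {t. n # t \<in> C} \<notin> Fin_power k}" for n
      by (rule Suc.IH[of "{t. n # t \<in> C}"]) (use that Suc.prems(2) in auto)
  qed
qed simp

lemma Fin_power_Un: "B \<in> Fin_power k \<Longrightarrow> C \<in> Fin_power k \<Longrightarrow> B \<union> C \<in> Fin_power k"
proof (induction k arbitrary: B C)
  case (Suc k)
  let ?N = "{n. {t. n # t \<in> B} \<notin> Fin_power k} \<union> {n. {t. n # t \<in> C} \<notin> Fin_power k}"
  show ?case
  proof (rule Fin_power_SucI)
    show "B \<union> C \<subseteq> seqs (Suc k)" using Suc.prems Fin_power_SucD(1) by simp
    show "finite ?N" using Suc.prems Fin_power_SucD(2) by simp
    fix n assume "n \<notin> ?N"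
    then have "{t. n # t \<in> B} \<union> {t. n # t \<in> C} \<in> Fin_power k" by (intro Suc.IH) simp_all
    then show "{t. n # t \<in> B \<union> C} \<in> Fin_power k" by (simp add: Collect_disj_eq)
  qed
qed simp

lemma Fin_power_UN:
  "finite I \<Longrightarrow> (\<And>i. i \<in> I \<Longrightarrow> C i \<in> Fin_power k) \<Longrightarrow> (\<Union>i\<in>I. C i) \<in> Fin_power k"
  by (induction I rule: finite_induct) (simp_all add: empty_mem_Fin_power Fin_power_Un)

lemma finite_mem_Fin_power:
  "finite C \<Longrightarrow> C \<subseteq> seqs (Suc k) \<Longrightarrow> C \<in> Fin_power (Suc k)"
proof (rule Fin_power_SucI[of _ _ "hd ` C"])
  fix n assume "n \<notin> hd ` C"
  then have "{t. n # t \<in> C} = {}" by force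
  then show "{t. n # t \<in> C} \<in> Fin_power k" by (simp only: empty_mem_Fin_power)
qed simp_all

lemma seqs_notin_Fin_power: "seqs k \<notin> Fin_power k"
proof (induction k)
  case 0
  have "[] \<in> seqs 0" by (simp add: seqs_def)
  then show ?case by auto
qed (simp add: Fin_power_Suc_iff)

lemma cylinder_mem_Fin_power:
  "B \<in> Fin_power k \<Longrightarrow> {t @ [y] | t y. t \<in> B} \<in> Fin_power (Suc k)"
proof (induction k arbitrary: B)
  case 0
  then show ?case by (simp add: empty_mem_Fin_power del: Fin_power.simps(2))
next
  case (Suc k)
  let ?C = "{t @ [y] | t y. t \<in> B}"
  have sec: "{t. n # t \<in> ?C} = {t @ [y] | t y. t \<in> {t. n # t \<in> B}}" for n
  proof (intro equalityI subsetI)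
    fix t assume "t \<in> {t. n # t \<in> ?C}"
    then obtain p y where p: "n # t = p @ [y]" "p \<in> B" by auto
    moreover from this have "p \<noteq> []"
      using Fin_power_SucD(1)[OF Suc.prems] by (auto simp: seqs_def)
    ultimately show "t \<in> {t @ [y] | t y. t \<in> {t. n # t \<in> B}}"
      by (cases p) auto
  next
    fix t assume "t \<in> {t @ [y] | t y. t \<in> {t. n # t \<in> B}}"
    then show "t \<in> {t. n # t \<in> ?C}" by force
  qed
  show ?case
  proof (rule Fin_power_SucI)
    show "?C \<subseteq> seqs (Suc (Suc k))"
      using Fin_power_SucD(1)[OF Suc.prems] by (auto simp: seqs_def)
    show "finite {n. {t. n # t \<in> B} \<notin> Fin_power k}" by (rule Fin_power_SucD(2)[OF Suc.prems])
    show "{t. n # t \<in> ?C} \<in> Fin_power (Suc k)" if "n \<notin> {n. {t. n # t \<in> B} \<notin> Fin_power k}" for n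
      unfolding sec by (rule Suc.IH) (use that in simp)
  qed
qed

lemma finite_fibres_mem_Fin_power:
  assumes "C \<subseteq> seqs (Suc k)" "\<And>t. t \<in> seqs k \<Longrightarrow> finite {y. t @ [y] \<in> C}"
  shows "C \<in> Fin_power (Suc k)"
  using assms
proof (induction k arbitrary: C)
  case 0
  have "C \<subseteq> (\<lambda>y. [y]) ` {y. [] @ [y] \<in> C}"
    using 0(1) by (auto simp: seqs_def length_Suc_conv)
  moreover have "finite {y. [] @ [y] \<in> C}" using 0(2)[of "[]"] by (simp add: seqs_def)
  ultimately have "finite C" by (blast intro: finite_subset)
  then show ?case using 0(1) by simp
next
  case (Suc k)
  have "{t. n # t \<in> C} \<in> Fin_power (Suc k)" for n
  proof (rule Suc.IH)
    show "{t. n # t \<in> C} \<subseteq> seqs (Suc k)" using Suc.prems(1) by auto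
    show "finite {y. t @ [y] \<in> {t. n # t \<in> C}}" if "t \<in> seqs k" for t
      using Suc.prems(2)[of "n # t"] that by simp
  qed
  then show ?case using Fin_power_SucI[OF Suc.prems(1) finite.emptyI] by simp
qed

text \<open>
  By induction, each row \<open>i\<close> of the domain carries a set \<open>Y i\<close> that is not small and on which the tails of the
  values of \<open>f\<close> form a small set. Shrink \<open>Y i\<close> so that the first entries of the values are either
  all at least \<open>i\<close> or all equal: if the first is impossible, finitely many first entries below
  \<open>i\<close> remain, and one of them is taken on a set that is not small. If one and the same first entry \<open>c\<close>
  occurs in this way on infinitely many rows, use these rows, as their image lies over \<open>c\<close>.
  Otherwise use all rows: only finitely many of them reach a given first entry, so each section
  of the image is a finite union of small sets.
\<close>

theorem no_Katetov_reduction_Fin_power_Suc: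
  assumes "\<And>u. u \<in> seqs n \<Longrightarrow> f u \<in> seqs (Suc n)"
  shows "\<exists>Y\<subseteq>seqs n. Y \<notin> Fin_power n \<and> f ` Y \<in> Fin_power (Suc n)"
  using assms
proof (induction n arbitrary: f)
  case 0
  have "seqs 0 = {[]}" by (auto simp: seqs_def)
  then show ?case using 0 seqs_notin_Fin_power[of 0] by (intro exI[of _ "seqs 0"]) auto
next
  case (Suc n)
  define a where "a i t = hd (f (i # t))" for i t
  define g where "g i t = tl (f (i # t))" for i t
  have g: "g i t \<in> seqs (Suc n)" if "t \<in> seqs n" for i t
    using Suc.prems[of "i # t"] that by (auto simp: g_def seqs_def)
  have f_eq: "f (i # t) = a i t # g i t" if "t \<in> seqs n" for i t
    using Suc.prems[of "i # t"] that by (cases "f (i # t)") (auto simp: a_def g_def seqs_def)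
  have "\<exists>Y. Y \<subseteq> seqs n \<and> Y \<notin> Fin_power n \<and> g i ` Y \<in> Fin_power (Suc n) \<and>
      ((\<forall>t\<in>Y. i \<le> a i t) \<or> (\<exists>c. \<forall>t\<in>Y. a i t = c))" for i
  proof -
    obtain Y where Y: "Y \<subseteq> seqs n" "Y \<notin> Fin_power n" "g i ` Y \<in> Fin_power (Suc n)"
      using Suc.IH[of "g i"] g by blast
    have shrink: "g i ` {t \<in> Y. P t} \<in> Fin_power (Suc n)" for P
      by (rule Fin_power_subset[OF Y(3)]) auto
    show ?thesis
    proof (cases "{t \<in> Y. i \<le> a i t} \<in> Fin_power n")
      case True
      have "Y = {t \<in> Y. i \<le> a i t} \<union> (\<Union>c\<in>{..<i}. {t \<in> Y. a i t = c})" by auto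
      then have "\<exists>c. {t \<in> Y. a i t = c} \<notin> Fin_power n"
        using Y(2) True by (metis (lifting) Fin_power_UN Fin_power_Un finite_lessThan)
      then obtain c where "{t \<in> Y. a i t = c} \<notin> Fin_power n" ..
      then show ?thesis
        using Y(1) shrink by (intro exI[of _ "{t \<in> Y. a i t = c}"]) auto
    next
      case False
      then show ?thesis
        using Y(1) shrink by (intro exI[of _ "{t \<in> Y. i \<le> a i t}"]) auto
    qed
  qed
  then obtain Y where Y: "\<And>i. Y i \<subseteq> seqs n" "\<And>i. Y i \<notin> Fin_power n"
      "\<And>i. g i ` Y i \<in> Fin_power (Suc n)"
      "\<And>i. (\<forall>t\<in>Y i. i \<le> a i t) \<or> (\<exists>c. \<forall>t\<in>Y i. a i t = c)"
    by metis
  have Y_seqs: "t \<in> seqs n" if "t \<in> Y i" for i t using Y(1) that by blast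
  define R where "R I = {i # t | i t. i \<in> I \<and> t \<in> Y i}" for I
  have R_sub: "R I \<subseteq> seqs (Suc n)" for I
    using Y_seqs by (auto simp: R_def)
  have R_img: "f ` R I \<subseteq> seqs (Suc (Suc n))" for I
    by (intro image_subsetI Suc.prems subsetD[OF R_sub])
  have R_pos: "R I \<notin> Fin_power (Suc n)" if "infinite I" for I
  proof
    assume "R I \<in> Fin_power (Suc n)"
    then have "finite {i. {t. i # t \<in> R I} \<notin> Fin_power n}" by (rule Fin_power_SucD(2))
    moreover have "I \<subseteq> {i. {t. i # t \<in> R I} \<notin> Fin_power n}"
      using Y(2) by (auto simp: R_def)
    ultimately show False using that finite_subset by blast
  qed
  show ?case
  proof (cases "\<exists>c. infinite {i. \<forall>t\<in>Y i. a i t = c}")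
    case True
    then obtain c where c: "infinite {i. \<forall>t\<in>Y i. a i t = c}" by blast
    let ?I = "{i. \<forall>t\<in>Y i. a i t = c}"
    have "{t. d # t \<in> f ` R ?I} \<in> Fin_power (Suc n)" if "d \<notin> {c}" for d
    proof -
      have "d = c" if t: "d # t \<in> f ` R ?I" for t
      proof -
        obtain i s where "i \<in> ?I" "s \<in> Y i" "d # t = f (i # s)"
          using t by (auto simp: R_def)
        then show ?thesis using f_eq[OF Y_seqs, of s i] by auto
      qed
      then have none: "{t. d # t \<in> f ` R ?I} = {}" using that by blast
      show ?thesis unfolding none by (rule empty_mem_Fin_power)
    qed
    then have "f ` R ?I \<in> Fin_power (Suc (Suc n))"
      by (intro Fin_power_SucI[OF R_img, of "{c}"]) simp
    then show ?thesis using R_sub R_pos[OF c] by blast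
  next
    case False
    have "{t. c # t \<in> f ` R UNIV} \<in> Fin_power (Suc n)" for c
    proof -
      have "{i. c \<in> a i ` Y i} \<subseteq> {..c} \<union> {i. \<forall>t\<in>Y i. a i t = c}"
        using Y(4) by fastforce
      then have "finite {i. c \<in> a i ` Y i}"
        using False by (blast intro: finite_subset)
      then have "(\<Union>i\<in>{i. c \<in> a i ` Y i}. g i ` Y i) \<in> Fin_power (Suc n)"
        by (rule Fin_power_UN) (rule Y(3))
      moreover have "{t. c # t \<in> f ` R UNIV} \<subseteq> (\<Union>i\<in>{i. c \<in> a i ` Y i}. g i ` Y i)"
      proof
        fix t assume "t \<in> {t. c # t \<in> f ` R UNIV}"
        then obtain i s where s: "s \<in> Y i" "c # t = f (i # s)" by (auto simp: R_def)
        then have "a i s = c" "g i s = t" using f_eq[OF Y_seqs[OF s(1)]] by auto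
        then show "t \<in> (\<Union>i\<in>{i. c \<in> a i ` Y i}. g i ` Y i)" using s(1) by blast
      qed
      ultimately show ?thesis by (rule Fin_power_subset)
    qed
    then have "f ` R UNIV \<in> Fin_power (Suc (Suc n))"
      by (intro Fin_power_SucI[OF R_img finite.emptyI])
    then show ?thesis using R_sub R_pos[of UNIV] by blast
  qed
qed

section \<open>Cells of a tree partition\<close>

lemma cell_child_subset: "tree_partition A \<Longrightarrow> A (s @ [n]) \<subseteq> A s"
  unfolding tree_partition_def by blast

lemma cell_append_subset: "tree_partition A \<Longrightarrow> A (s @ t) \<subseteq> A s"
proof (induction t rule: rev_induct)
  case (snoc n t)
  then show ?case using cell_child_subset[of A "s @ t" n] by auto
qed simp

lemma mem_cell_restr_branch: "tree_partition A \<Longrightarrow> x \<in> A (restr (branch A x) n)"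
  using theI'[OF branch_ex1, of A x] by (simp add: branch_def)

lemma restr_branch_of_mem:
  assumes "tree_partition A" "x \<in> A u"
  shows "restr (branch A x) (length u) = u"
  using assms(2)
proof (induction u rule: rev_induct)
  case Nil
  then show ?case by (simp add: restr_def)
next
  case (snoc n u)
  then have u: "restr (branch A x) (length u) = u"
    using cell_child_subset[OF assms(1)] by blast
  then have "x \<in> A (u @ [branch A x (length u)])"
    using mem_cell_restr_branch[OF assms(1), of x "Suc (length u)"] by (simp add: restr_Suc)
  moreover have "disjoint_family (\<lambda>n. A (u @ [n]))"
    using assms(1) by (simp add: tree_partition_def)
  ultimately have "branch A x (length u) = n"
    using snoc.prems by (auto simp: disjoint_family_on_def)
  then show ?case using u by (simp add: restr_Suc)
qed

lemma branch_nth_of_mem: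
  assumes "tree_partition A" "x \<in> A u" "i < length u"
  shows "branch A x i = u ! i"
proof -
  have "u ! i = restr (branch A x) (length u) ! i"
    using restr_branch_of_mem[OF assms(1,2)] by simp
  then show ?thesis using assms(3) by (simp add: restr_def)
qed

section \<open>Positivity of a given rank at a node\<close>

primrec positive :: "(nat list \<Rightarrow> nat set) \<Rightarrow> nat \<Rightarrow> nat list \<Rightarrow> nat set \<Rightarrow> bool" where
  "positive A 0 s X \<longleftrightarrow> infinite (X \<inter> A s)"
| "positive A (Suc n) s X \<longleftrightarrow> infinite {k. positive A n (s @ [k]) X}"

lemma positive_Suc_transfer:
  assumes "positive A (Suc n) s X"
    and "\<And>k. positive A n (s @ [k]) X \<Longrightarrow> positive A n' (s @ [k]) Y"
  shows "positive A (Suc n') s Y"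
proof -
  have "{k. positive A n (s @ [k]) X} \<subseteq> {k. positive A n' (s @ [k]) Y}"
    using assms(2) by (rule Collect_mono[OF impI])
  moreover have "infinite {k. positive A n (s @ [k]) X}"
    using assms(1) by (simp only: positive.simps(2) not_False_eq_True)
  ultimately show ?thesis
    unfolding positive.simps(2) by (rule infinite_super)
qed

lemma positive_mono: "positive A n s X \<Longrightarrow> X \<subseteq> Y \<Longrightarrow> positive A n s Y"
proof (induction n arbitrary: s)
  case 0
  then have "X \<inter> A s \<subseteq> Y \<inter> A s" by blast
  from infinite_super[OF this] show ?case using 0(1) by simp
next
  case (Suc n)
  show ?case by (rule positive_Suc_transfer[OF Suc.prems(1)]) (rule Suc.IH[OF _ Suc.prems(2)])
qed

lemma positive_Un: "positive A n s (X \<union> Y) \<Longrightarrow> positive A n s X \<or> positive A n s Y"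
proof (induction n arbitrary: s)
  case 0
  then show ?case by (simp add: Int_Un_distrib2)
next
  case (Suc n)
  have "{k. positive A n (s @ [k]) (X \<union> Y)} \<subseteq>
      {k. positive A n (s @ [k]) X} \<union> {k. positive A n (s @ [k]) Y}"
    using Suc.IH by blast
  from infinite_super[OF this] show ?case using Suc.prems by simp
qed

lemma not_positive_empty: "\<not> positive A n s {}"
  by (induction n arbitrary: s) auto

lemma positive_UN:
  "finite I \<Longrightarrow> positive A n s (\<Union>i\<in>I. X i) \<Longrightarrow> \<exists>i\<in>I. positive A n s (X i)"
proof (induction I rule: finite_induct)
  case (insert i I)
  then show ?case using positive_Un[of A n s "X i"] by auto
qed (simp add: not_positive_empty)

text \<open>Passing from rank \<open>1\<close> to rank \<open>0\<close> uses that each cell contains the cells of its children.\<close>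

lemma positive_Suc_imp:
  assumes "tree_partition A"
  shows "positive A (Suc n) s X \<Longrightarrow> positive A n s X"
proof (induction n arbitrary: s)
  case 0
  then have "{k. positive A 0 (s @ [k]) X} \<noteq> {}" by force
  then obtain k where "infinite (X \<inter> A (s @ [k]))" by auto
  moreover have "X \<inter> A (s @ [k]) \<subseteq> X \<inter> A s" using cell_child_subset[OF assms] by blast
  ultimately show ?case using infinite_super by (simp only: positive.simps) blast
next
  case (Suc n)
  show ?case by (rule positive_Suc_transfer[OF Suc.prems]) (rule Suc.IH)
qed

lemma positive_antimono:
  assumes "tree_partition A" "n \<le> N" "positive A N s X"
  shows "positive A n s X"
  using assms(2,3) by (induction rule: dec_induct) (blast dest: positive_Suc_imp[OF assms(1)])+

lemma positive_Int_cell: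
  assumes "tree_partition A"
  shows "positive A n s X \<Longrightarrow> positive A n s (X \<inter> A s)"
proof (induction n arbitrary: s)
  case (Suc n)
  show ?case
  proof (rule positive_Suc_transfer[OF Suc.prems])
    fix k assume "positive A n (s @ [k]) X"
    then have "positive A n (s @ [k]) (X \<inter> A (s @ [k]))" by (rule Suc.IH)
    then show "positive A n (s @ [k]) (X \<inter> A s)"
      by (rule positive_mono) (use cell_child_subset[OF assms] in blast)
  qed
qed simp

lemma positive_superset_cell:
  assumes "tree_partition A"
  shows "A s \<subseteq> X \<Longrightarrow> positive A n s X"
proof (induction n arbitrary: s)
  case 0
  then have "X \<inter> A s = A s" by blast
  then show ?case using assms by (simp add: tree_partition_def)
next
  case (Suc n)
  have "positive A n (s @ [k]) X" for k
    using Suc cell_child_subset[OF assms, of s k] by blast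
  then show ?case by simp
qed

lemma mem_deriv_tree_iff_positive:
  assumes "tree_partition A"
  shows "s \<in> (deriv_tree ^^ n) (inf_tree A X) \<longleftrightarrow> positive A n s X"
proof (induction n arbitrary: s)
  case 0
  show ?case by (simp add: inf_tree_def)
next
  case (Suc n)
  then show ?case
    using positive_Suc_imp[OF assms, of n s X] by (auto simp: deriv_tree_def Succ_def)
qed

lemma mem_H_iff: "tree_partition A \<Longrightarrow> X \<in> H A n \<longleftrightarrow> \<not> positive A n [] X"
  by (simp add: H_def mem_deriv_tree_iff_positive)

lemma mem_H_fin_iff: "tree_partition A \<Longrightarrow> X \<in> H_fin A \<longleftrightarrow> (\<exists>n. \<not> positive A n [] X)"
  by (simp add: H_fin_def mem_H_iff)

text \<open>The recursions for positivity and for the tensor powers of Fin agree level by level; at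
  \<open>m = 0\<close> the ideal \<open>{{}}\<close> on the one-point set turns the right-hand side into positivity at
  \<open>s\<close> itself.\<close>

lemma positive_add_iff:
  "positive A (m + r) s X \<longleftrightarrow> {u \<in> seqs m. positive A r (s @ u) X} \<notin> Fin_power m"
proof (induction m arbitrary: s)
  case 0
  have "seqs 0 = {[]}" by (auto simp: seqs_def)
  then show ?case by auto
next
  case (Suc m)
  let ?C = "{u \<in> seqs (Suc m). positive A r (s @ u) X}"
  have sec: "{t. k # t \<in> ?C} = {u \<in> seqs m. positive A r ((s @ [k]) @ u) X}" for k
    by simp
  have "?C \<subseteq> seqs (Suc m)" by blast
  moreover have "positive A (Suc m + r) s X \<longleftrightarrow>
      infinite {k. {t. k # t \<in> ?C} \<notin> Fin_power m}"
    unfolding sec add_Suc positive.simps(2) Suc.IH ..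
  ultimately show ?case unfolding Fin_power_Suc_iff by blast
qed

lemma positive_add_of_all:
  assumes "\<And>u. u \<in> seqs m \<Longrightarrow> positive A r u X"
  shows "positive A (m + r) [] X"
proof -
  have all: "{u \<in> seqs m. positive A r ([] @ u) X} = seqs m" using assms by auto
  show ?thesis unfolding positive_add_iff all by (rule seqs_notin_Fin_power)
qed

lemma not_positive_add_of_none:
  assumes "\<And>u. u \<in> seqs m \<Longrightarrow> \<not> positive A r u X"
  shows "\<not> positive A (m + r) [] X"
proof -
  have none: "{u \<in> seqs m. positive A r ([] @ u) X} = {}" using assms by auto
  show ?thesis unfolding positive_add_iff none by (simp add: empty_mem_Fin_power)
qed

section \<open>The canonical fragment\<close>

lemma tuple_map_Suc: "tuple_map \<xi> (Suc k) x = \<xi> (Suc k) x # tuple_map \<xi> k x"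
  by (simp add: tuple_map_def)

lemma length_tuple_map [simp]: "length (tuple_map \<xi> k x) = k"
  by (simp add: tuple_map_def)

lemma canonical_fragment_first:
  assumes "tree_partition A" "x \<in> A u" "length u = K - 1"
  shows "canonical_fragment A K e 1 x = e u x"
  using restr_branch_of_mem[OF assms(1,2)] assms(3) by (simp add: canonical_fragment_def)

lemma canonical_fragment_later:
  assumes "tree_partition A" "x \<in> A u" "j \<noteq> 1" "K - j < length u"
  shows "canonical_fragment A K e j x = u ! (K - j)"
  using branch_nth_of_mem[OF assms(1,2,4)] assms(3) by (simp add: canonical_fragment_def)

lemma finite_bij_preimage:
  assumes "bij_betw f S UNIV" "finite B"
  shows "finite {x \<in> S. f x \<in> B}"
proof -
  have "inj_on f {x \<in> S. f x \<in> B}"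
    using assms(1) by (auto simp: bij_betw_def intro: inj_on_subset)
  moreover have "finite (f ` {x \<in> S. f x \<in> B})"
    by (rule finite_subset[OF _ assms(2)]) auto
  ultimately show ?thesis by (rule finite_imageD[rotated])
qed

text \<open>On a cell of level \<open>K - 1\<close> the function \<open>\<xi> 2\<close> is constant, so there the test bounds the
  injective function \<open>\<xi> 1\<close> by a constant.\<close>

lemma graph_test_canonical_mem_H:
  assumes "tree_partition A" "K \<ge> 2"
    and e: "\<And>u. u \<in> seqs (K - 1) \<Longrightarrow> bij_betw (e u) (A u) UNIV"
  shows "graph_test (canonical_fragment A K e 2) (canonical_fragment A K e 1) h \<in> H A (K - 1)"
    (is "?X \<in> _")
proof -
  have "\<not> positive A 0 u ?X" if u: "u \<in> seqs (K - 1)" for u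
  proof -
    have len: "length u = K - 1" using u by (simp add: seqs_def)
    have "?X \<inter> A u \<subseteq> {x \<in> A u. e u x \<in> {..h (u ! (K - 2))}}"
    proof
      fix x assume x: "x \<in> ?X \<inter> A u"
      then have "canonical_fragment A K e 1 x = e u x"
          "canonical_fragment A K e 2 x = u ! (K - 2)"
        using canonical_fragment_first[OF assms(1) _ len]
          canonical_fragment_later[OF assms(1), of x u 2 K] len assms(2) by auto
      then show "x \<in> {x \<in> A u. e u x \<in> {..h (u ! (K - 2))}}"
        using x by (simp add: graph_test_def)
    qed
    then show ?thesis using finite_bij_preimage[OF e[OF u], of "{..h (u ! (K - 2))}"]
      by (auto intro: finite_subset)
  qed
  then show ?thesis using not_positive_add_of_none[of "K - 1" A 0 ?X] assms(1)
    by (simp add: mem_H_iff)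
qed

text \<open>The graph test of the zero function contains the zero of \<open>\<xi> 1\<close> in each cell of level
  \<open>K - 1\<close>, and a cell of smaller level contains infinitely many of these cells.\<close>

lemma zero_graph_test_notin_H:
  assumes "tree_partition A"
    and e: "\<And>u. u \<in> seqs (K - 1) \<Longrightarrow> bij_betw (e u) (A u) UNIV"
    and "l < K - 1"
  shows "graph_test \<phi> (canonical_fragment A K e 1) (\<lambda>_. 0) \<notin> H A l"
    (is "?X \<notin> _")
proof -
  have "positive A 0 u ?X" if u: "u \<in> seqs l" for u
  proof -
    define v where "v n = u @ n # replicate (K - 2 - l) 0" for n :: nat
    have v: "v n \<in> seqs (K - 1)" for n using u assms(3) by (simp add: v_def seqs_def)
    have "0 \<in> e (v n) ` A (v n)" for n
      using bij_betw_imp_surj_on[OF e[OF v[of n]]] by simp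
    then have "\<exists>x\<in>A (v n). e (v n) x = 0" for n
      by (metis imageE)
    then obtain z where z: "\<And>n. z n \<in> A (v n)" "\<And>n. e (v n) (z n) = 0" by metis
    have "branch A (z n) l = n" for n
      using branch_nth_of_mem[OF assms(1) z(1)[of n], of l] u by (simp add: v_def seqs_def nth_append)
    then have "inj z" by (metis injI)
    moreover have "z n \<in> ?X \<inter> A u" for n
    proof
      show "z n \<in> ?X"
        using canonical_fragment_first[OF assms(1) z(1)[of n], of K e] v[of n] z(2)[of n]
        by (simp add: graph_test_def seqs_def)
      show "z n \<in> A u" using z(1)[of n] cell_append_subset[OF assms(1)]
        unfolding v_def by blast
    qed
    then have "range z \<subseteq> ?X \<inter> A u" by blast
    ultimately show ?thesis using range_inj_infinite infinite_super unfolding positive.simps by blast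
  qed
  then show ?thesis using positive_add_of_all[of l A 0 ?X] assms(1) by (simp add: mem_H_iff)
qed

text \<open>On the cell of a node of level \<open>K - Suc k\<close> the tuple map of length \<open>Suc k\<close> reads off the
  next \<open>k\<close> entries of the branch followed by the index within the cell of level \<open>K - 1\<close>, so
  preimages of small sets are not positive of rank \<open>k\<close> there.\<close>

lemma not_positive_canonical_preimage:
  assumes "tree_partition A"
    and e: "\<And>u. u \<in> seqs (K - 1) \<Longrightarrow> bij_betw (e u) (A u) UNIV"
  shows "Suc k \<le> K \<Longrightarrow> u \<in> seqs (K - Suc k) \<Longrightarrow> B \<in> Fin_power (Suc k) \<Longrightarrow>
    \<not> positive A k u (tuple_map (canonical_fragment A K e) (Suc k) -` B)"
proof (induction k arbitrary: u B)
  case 0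
  let ?\<xi> = "canonical_fragment A K e"
  have u: "u \<in> seqs (K - 1)" and B: "finite B" using 0 by simp_all
  then have len: "length u = K - 1" by (simp add: seqs_def)
  have "tuple_map ?\<xi> (Suc 0) -` B \<inter> A u \<subseteq> {x \<in> A u. e u x \<in> hd ` B}"
  proof
    fix x assume x: "x \<in> tuple_map ?\<xi> (Suc 0) -` B \<inter> A u"
    then have "[e u x] \<in> B"
      using canonical_fragment_first[OF assms(1) _ len, of x e] by (simp add: tuple_map_def)
    then show "x \<in> {x \<in> A u. e u x \<in> hd ` B}" using x by force
  qed
  moreover have "finite {x \<in> A u. e u x \<in> hd ` B}"
    by (rule finite_bij_preimage[OF e[OF u]]) (use B in simp)
  ultimately show ?case by (auto intro: finite_subset)
next
  case (Suc k)
  let ?\<xi> = "canonical_fragment A K e"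
  let ?X = "tuple_map ?\<xi> (Suc (Suc k)) -` B"
  have len: "length u = K - Suc (Suc k)" using Suc.prems by (simp add: seqs_def)
  have "\<not> positive A k (u @ [n]) ?X" if n: "{t. n # t \<in> B} \<in> Fin_power (Suc k)" for n
  proof
    assume "positive A k (u @ [n]) ?X"
    then have "positive A k (u @ [n]) (?X \<inter> A (u @ [n]))"
      by (rule positive_Int_cell[OF assms(1)])
    moreover have "?X \<inter> A (u @ [n]) \<subseteq> tuple_map ?\<xi> (Suc k) -` {t. n # t \<in> B}"
    proof
      fix x assume x: "x \<in> ?X \<inter> A (u @ [n])"
      then have "?\<xi> (Suc (Suc k)) x = n"
        using canonical_fragment_later[OF assms(1), of x "u @ [n]" "Suc (Suc k)" K e] len
        by (simp add: nth_append)
      then show "x \<in> tuple_map ?\<xi> (Suc k) -` {t. n # t \<in> B}"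
        using x by (simp add: tuple_map_Suc)
    qed
    ultimately have "positive A k (u @ [n]) (tuple_map ?\<xi> (Suc k) -` {t. n # t \<in> B})"
      by (rule positive_mono)
    moreover have "u @ [n] \<in> seqs (K - Suc k)"
      using len Suc.prems(1) by (simp add: seqs_def)
    ultimately show False using Suc.IH[OF _ _ n] Suc.prems(1) by simp
  qed
  then have "{n. positive A k (u @ [n]) ?X} \<subseteq> {n. {t. n # t \<in> B} \<notin> Fin_power (Suc k)}"
    by blast
  moreover have "finite {n. {t. n # t \<in> B} \<notin> Fin_power (Suc k)}"
    by (rule Fin_power_SucD(2)[OF Suc.prems(3)])
  ultimately show ?case by (auto intro: finite_subset)
qed

lemma canonical_fragment_coherent:
  assumes "tree_partition A" "K \<ge> 2"
    and e: "\<And>u. u \<in> seqs (K - 1) \<Longrightarrow> bij_betw (e u) (A u) UNIV"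
  shows "coherent_window_extending A K (canonical_fragment A K e 2) (canonical_fragment A K e 1)
    (canonical_fragment A K e)"
proof -
  let ?\<xi> = "canonical_fragment A K e"
  have "katetov_witness A (Suc k) (tuple_map ?\<xi> (Suc k))" if k: "Suc k \<le> K" for k
    unfolding katetov_witness_def
  proof (intro conjI ballI)
    show "range (tuple_map ?\<xi> (Suc k)) \<subseteq> seqs (Suc k)" by (auto simp: seqs_def)
    fix B assume B: "B \<in> Fin_power (Suc k)"
    have "\<not> positive A ((K - Suc k) + k) [] (tuple_map ?\<xi> (Suc k) -` B)"
      by (rule not_positive_add_of_none)
        (rule not_positive_canonical_preimage[OF assms(1) e k _ B])
    then show "tuple_map ?\<xi> (Suc k) -` B \<in> H_fin A"
      using assms(1) by (auto simp: mem_H_fin_iff)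
  qed
  then have "katetov_witness A k (tuple_map ?\<xi> k)" if "1 \<le> k" "k \<le> K" for k
    using that by (cases k) auto
  then show ?thesis using assms(2) by (simp add: coherent_window_extending_def)
qed

section \<open>The essential depth\<close>

text \<open>At levels \<open>d\<close> with \<open>K - 1 \<le> d\<close> the function \<open>\<xi> 2\<close> is constant on each cell. For smaller
  \<open>d\<close>, if \<open>\<xi> 2\<close> has finitely many values on \<open>A t - Z\<close> for a node \<open>t\<close> of level \<open>K - 2\<close>, then \<open>Z\<close>
  contains all but finitely many of the cells of the children of \<open>t\<close>, as \<open>\<xi> 2\<close> tells them apart.
  So \<open>Z\<close> is positive of every rank at every such \<open>t\<close>.\<close>

lemma depth_bound_canonical_iff:
  assumes "tree_partition A" "K \<ge> 2"
  shows "depth_bound A (canonical_fragment A K e 2) d \<longleftrightarrow> K - 1 \<le> d"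
proof
  let ?\<phi> = "canonical_fragment A K e 2"
  have children: "?\<phi> x = n" if "t \<in> seqs (K - 2)" "x \<in> A (t @ [n])" for x t n
    using canonical_fragment_later[OF assms(1) that(2), of 2 K e] that(1)
    by (simp add: seqs_def nth_append)
  assume "depth_bound A ?\<phi> d"
  then obtain Z where Z: "Z \<in> H_fin A" "\<And>s. s \<in> seqs d \<Longrightarrow> finite (?\<phi> ` (A s - Z))"
    by (auto simp: depth_bound_def)
  show "K - 1 \<le> d"
  proof (rule ccontr)
    assume "\<not> K - 1 \<le> d"
    then have d: "d \<le> K - 2" by simp
    obtain r where r: "\<not> positive A r [] Z"
      using Z(1) assms(1) by (auto simp: mem_H_fin_iff)
    have "positive A (Suc r) t Z" if t: "t \<in> seqs (K - 2)" for t
    proof -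
      have "take d t \<in> seqs d" using t d by (simp add: seqs_def)
      then have "finite (?\<phi> ` (A (take d t) - Z))" by (rule Z(2))
      moreover have "A t \<subseteq> A (take d t)"
        using cell_append_subset[OF assms(1), of "take d t" "drop d t"] by simp
      ultimately have fin: "finite (?\<phi> ` (A t - Z))"
        by (meson Diff_mono finite_subset image_mono order_refl)
      have "A (t @ [n]) \<subseteq> Z" if "n \<notin> ?\<phi> ` (A t - Z)" for n
      proof
        fix x assume x: "x \<in> A (t @ [n])"
        then have "x \<in> A t" "?\<phi> x = n"
          using children[OF t x] cell_child_subset[OF assms(1)] by auto
        then show "x \<in> Z" using that by blast
      qed
      then have "- (?\<phi> ` (A t - Z)) \<subseteq> {n. positive A r (t @ [n]) Z}"
        using positive_superset_cell[OF assms(1)] by blast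
      moreover have "infinite (- (?\<phi> ` (A t - Z)))" using fin by simp
      ultimately show ?thesis using infinite_super unfolding positive.simps by blast
    qed
    then have "positive A (K - 2 + Suc r) [] Z" by (rule positive_add_of_all)
    then have "positive A r [] Z" by (rule positive_antimono[OF assms(1), rotated]) simp
    then show False using r by blast
  qed
next
  let ?\<phi> = "canonical_fragment A K e 2"
  assume d: "K - 1 \<le> d"
  have "?\<phi> ` (A s - {}) \<subseteq> {s ! (K - 2)}" if "s \<in> seqs d" for s
    using canonical_fragment_later[OF assms(1), of _ s 2 K e] that d assms(2)
    by (auto simp: seqs_def)
  then have "finite (?\<phi> ` (A s - {}))" if "s \<in> seqs d" for s
    using that by (meson finite.emptyI finite.insertI finite_subset)
  moreover have "{} \<in> H_fin A" using assms(1) by (simp add: mem_H_fin_iff not_positive_empty)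
  ultimately show "depth_bound A ?\<phi> d"
    using d assms(2) unfolding depth_bound_def by (intro conjI bexI[of _ "{}"]) auto
qed

lemma essential_depth_canonical:
  assumes "tree_partition A" "K \<ge> 2"
  shows "essential_depth A (canonical_fragment A K e 2) = enat (K - 1)"
  unfolding essential_depth_def depth_bound_canonical_iff[OF assms]
  by (auto intro!: Least_equality)

section \<open>No longer coherent window\<close>

text \<open>
  Number the nodes \<open>u\<close> by \<open>to_nat\<close> and let \<open>h c\<close> bound the last entries of all nodes with number
  at most \<open>c\<close>. The sequences whose last entry \<open>y\<close> satisfies \<open>y \<le> h c\<close> for some earlier entry
  \<open>c\<close> form a small set. Off its preimage \<open>Z\<close>, every entry of \<open>w\<close> on \<open>A u\<close> is less than the
  number of \<open>u\<close>, so \<open>w\<close> has finitely many values there. For a suitable rank \<open>r0\<close>,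
  the set \<open>Z\<close> is positive of rank \<open>r0\<close> only at a small set of nodes \<open>u\<close>. At the other nodes the rest
  of \<open>A u\<close> is positive of all ranks from \<open>r0\<close> on, so some value \<open>f u\<close> of the sequence map is taken on a set that is
  positive at \<open>u\<close> of rank at least the number of \<open>u\<close>. Only finitely many nodes have a number below
  a given rank, so the union of such sets over a set of nodes that is not small is positive of every
  rank at the root. As \<open>f\<close> is not a Katetov reduction, this applies to the preimage
  of some small set.
\<close>

lemma no_witness_constant_last_entry:
  assumes A: "tree_partition A" and "m \<ge> 1"
    and w: "\<And>x. w x \<in> seqs m"
    and small: "\<And>B. B \<in> Fin_power (Suc m) \<Longrightarrow>
      (\<lambda>x. w x @ [branch A x (m - 1)]) -` B \<in> H_fin A"
  shows False
proof -
  define q where "q x = w x @ [branch A x (m - 1)]" for x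
  have q_small: "q -` B \<in> H_fin A" if "B \<in> Fin_power (Suc m)" for B
    using small[OF that] by (simp add: q_def[abs_def])
  have q_cell: "q x = w x @ [last u]" if "u \<in> seqs m" "x \<in> A u" for x u
  proof -
    have "u \<noteq> []" "length u = m" using that(1) assms(2) by (auto simp: seqs_def)
    then show ?thesis
      using branch_nth_of_mem[OF A that(2), of "m - 1"] assms(2)
      by (simp add: q_def last_conv_nth)
  qed

  \<comment> \<open>The sum is a convenient upper bound for the finitely many last entries.\<close>
  define h :: "nat \<Rightarrow> nat" where "h c = (\<Sum>i\<le>c. last (from_nat i :: nat list))" for c
  have h: "last u \<le> h c" if "to_nat u \<le> c" for u :: "nat list" and c
  proof -
    have "last (from_nat (to_nat u) :: nat list) \<le> h c"
      unfolding h_def by (rule member_le_sum) (use that in auto)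
    then show ?thesis by simp
  qed
  let ?B = "{t @ [y] | t y. t \<in> seqs m \<and> (\<exists>c\<in>set t. y \<le> h c)}"
  define Z where "Z = q -` ?B"
  have "?B \<in> Fin_power (Suc m)"
  proof (rule finite_fibres_mem_Fin_power)
    show "?B \<subseteq> seqs (Suc m)" by (auto simp: seqs_def)
    fix t :: "nat list"
    have "{y. t @ [y] \<in> ?B} \<subseteq> (\<Union>c\<in>set t. {..h c})" by auto
    then show "finite {y. t @ [y] \<in> ?B}" by (rule finite_subset) simp
  qed
  then have "Z \<in> H_fin A" unfolding Z_def by (rule q_small)
  then obtain r0 where "\<not> positive A r0 [] Z"
    using A by (auto simp: mem_H_fin_iff)
  then have "\<not> positive A (m + r0) [] Z"
    using positive_antimono[OF A, of r0 "m + r0"] by auto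
  then have bad: "{u \<in> seqs m. positive A r0 u Z} \<in> Fin_power m"
    unfolding positive_add_iff by simp

  have "\<exists>v. v \<in> seqs (Suc m) \<and>
      (positive A r0 u Z \<or> positive A (to_nat u) u {x. q x = v})"
    if u: "u \<in> seqs m" for u
  proof (cases "positive A r0 u Z")
    case True
    \<comment> \<open>Any value will do at the exceptional nodes.\<close>
    moreover have "0 # u \<in> seqs (Suc m)" using u by simp
    ultimately show ?thesis by blast
  next
    case False
    define r where "r = max r0 (to_nat u)"
    have "positive A r u (Z \<union> (A u - Z))"
      by (rule positive_superset_cell[OF A]) blast
    moreover have "\<not> positive A r u Z"
      using False positive_antimono[OF A, of r0 r] by (auto simp: r_def)
    ultimately have rest: "positive A r u (A u - Z)"
      using positive_Un by blast
    let ?V = "{v. set v \<subseteq> {..<to_nat u} \<and> length v = m}"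
    have "A u - Z \<subseteq> (\<Union>v\<in>?V. {x. q x = v @ [last u]})"
    proof
      fix x assume x: "x \<in> A u - Z"
      then have qx: "q x = w x @ [last u]" using q_cell[OF u] by blast
      have "c < to_nat u" if "c \<in> set (w x)" for c
      proof (rule ccontr)
        assume "\<not> c < to_nat u"
        then have "last u \<le> h c" by (intro h) simp
        then have "q x \<in> ?B" using w[of x] that unfolding qx by blast
        then show False using x unfolding Z_def by blast
      qed
      then have "w x \<in> ?V" using w[of x] by (auto simp: seqs_def)
      then show "x \<in> (\<Union>v\<in>?V. {x. q x = v @ [last u]})" using qx by blast
    qed
    then have "positive A r u (\<Union>v\<in>?V. {x. q x = v @ [last u]})"
      using rest positive_mono by blast
    moreover have "finite ?V" by (rule finite_lists_length_eq) simp
    ultimately obtain v where v: "v \<in> ?V" "positive A r u {x. q x = v @ [last u]}"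
      using positive_UN by blast
    then have "positive A (to_nat u) u {x. q x = v @ [last u]}"
      using positive_antimono[OF A, of "to_nat u" r] by (auto simp: r_def)
    moreover have "v @ [last u] \<in> seqs (Suc m)" using v(1) by (simp add: seqs_def)
    ultimately show ?thesis by blast
  qed
  then have "\<forall>u\<in>seqs m. \<exists>v. v \<in> seqs (Suc m) \<and>
      (positive A r0 u Z \<or> positive A (to_nat u) u {x. q x = v})"
    by (rule ballI)
  from bchoice[OF this] obtain f where f: "\<forall>u\<in>seqs m. f u \<in> seqs (Suc m) \<and>
      (positive A r0 u Z \<or> positive A (to_nat u) u {x. q x = f u})" ..
  obtain Y where Y: "Y \<subseteq> seqs m" "Y \<notin> Fin_power m" "f ` Y \<in> Fin_power (Suc m)"
    using no_Katetov_reduction_Fin_power_Suc[of m f] f by blast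
  obtain r where r: "\<not> positive A r [] (q -` (f ` Y))"
    using q_small[OF Y(3)] A by (auto simp: mem_H_fin_iff)
  let ?G = "{u \<in> seqs m. positive A r u (q -` (f ` Y))}"
  have "Y \<subseteq> {u \<in> seqs m. positive A r0 u Z} \<union> {u \<in> seqs m. to_nat u < r} \<union> ?G"
  proof
    fix u assume u: "u \<in> Y"
    have "u \<in> ?G" if "\<not> positive A r0 u Z" "r \<le> to_nat u"
    proof -
      have "positive A (to_nat u) u {x. q x = f u}" using f that(1) u Y(1) by blast
      then have "positive A r u {x. q x = f u}" using positive_antimono[OF A that(2)] by blast
      then have "positive A r u (q -` (f ` Y))" by (rule positive_mono) (use u in auto)
      then show ?thesis using u Y(1) by blast
    qed
    then show "u \<in> {u \<in> seqs m. positive A r0 u Z} \<union> {u \<in> seqs m. to_nat u < r} \<union> ?G"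
      using u Y(1) by (cases "r \<le> to_nat u") auto
  qed
  moreover have "{u \<in> seqs m. to_nat u < r} \<in> Fin_power m"
  proof -
    have "finite (to_nat -` {..<r} :: nat list set)"
      by (rule finite_vimageI) (simp_all add: inj_to_nat)
    then have "finite {u \<in> seqs m. to_nat u < r}"
      by (rule finite_subset[rotated]) auto
    then show ?thesis using finite_mem_Fin_power[of _ "m - 1"] assms(2) by auto
  qed
  ultimately have "?G \<notin> Fin_power m"
    using Y(2) bad by (meson Fin_power_Un Fin_power_subset)
  then have "positive A (m + r) [] (q -` (f ` Y))" unfolding positive_add_iff by simp
  then have "positive A r [] (q -` (f ` Y))"
    by (rule positive_antimono[OF A, rotated]) simp
  then show False using r by blast
qed

text \<open>Preimages of cylinders over small sets show that a window without its last function
  still pulls small sets back into \<open>H_fin A\<close>. Its last entry is then \<open>\<xi> 2\<close>, the branch entry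
  at \<open>K - 2\<close>.\<close>

lemma no_longer_coherent_window:
  assumes "tree_partition A" "K \<ge> 2"
  shows "\<not> coherent_window_extending A (K + 1) (canonical_fragment A K e 2) \<psi> \<zeta>"
proof
  assume window: "coherent_window_extending A (K + 1) (canonical_fragment A K e 2) \<psi> \<zeta>"
  define w where "w x = map (\<lambda>j. \<zeta> j x) (rev [3..<K + 2])" for x
  have \<zeta>2: "\<zeta> 2 x = branch A x (K - 2)" for x
    using window by (simp add: coherent_window_extending_def canonical_fragment_def)
  have "[1..<K + 2] = 1 # 2 # [3..<K + 2]"
    using assms(2) by (simp add: upt_conv_Cons numeral_eq_Suc)
  then have tuple: "tuple_map \<zeta> (K + 1) x = (w x @ [branch A x (K - 2)]) @ [\<zeta> 1 x]" for x
    by (simp add: tuple_map_def w_def \<zeta>2)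
  show False
  proof (rule no_witness_constant_last_entry[OF assms(1), of "K - 1" w])
    show "1 \<le> K - 1" using assms(2) by simp
    show "w x \<in> seqs (K - 1)" for x by (simp add: w_def seqs_def del: upt_Suc)
    fix B assume "B \<in> Fin_power (Suc (K - 1))"
    then have "{t @ [y] | t y. t \<in> B} \<in> Fin_power (Suc (Suc (K - 1)))"
      by (rule cylinder_mem_Fin_power)
    moreover have "Suc (Suc (K - 1)) = K + 1" using assms(2) by simp
    ultimately have C: "{t @ [y] | t y. t \<in> B} \<in> Fin_power (K + 1)" by (simp only:)
    have "katetov_witness A (K + 1) (tuple_map \<zeta> (K + 1))"
      using window by (simp add: coherent_window_extending_def)
    then have "\<forall>B\<in>Fin_power (K + 1). tuple_map \<zeta> (K + 1) -` B \<in> H_fin A"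
      unfolding katetov_witness_def by (rule conjunct2)
    from bspec[OF this C] have "tuple_map \<zeta> (K + 1) -` {t @ [y] | t y. t \<in> B} \<in> H_fin A" .
    moreover have "tuple_map \<zeta> (K + 1) -` {t @ [y] | t y. t \<in> B} =
        (\<lambda>x. w x @ [branch A x (K - 1 - 1)]) -` B"
    proof -
      have K: "K - 1 - 1 = K - 2" by simp
      show ?thesis unfolding K vimage_def tuple by auto
    qed
    ultimately show "(\<lambda>x. w x @ [branch A x (K - 1 - 1)]) -` B \<in> H_fin A" by simp
  qed
qed

theorem proposition4p17:
  fixes A :: "nat list \<Rightarrow> nat set"
    and K m :: nat
    and e :: "nat list \<Rightarrow> nat \<Rightarrow> nat"
    and \<xi> :: "nat \<Rightarrow> nat \<Rightarrow> nat"
  assumes "tree_partition A"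
    and "K \<ge> 2"
    and "\<And>u. u \<in> seqs (K - 1) \<Longrightarrow> bij_betw (e u) (A u) UNIV"
    and "\<xi> = canonical_fragment A K e"
    and "m = K - 1"
  shows "(\<forall>h. graph_test (\<xi> 2) (\<xi> 1) h \<in> H A (K - 1)) \<and>
     essential_depth A (\<xi> 2) = enat (K - 1) \<and>
     (1 \<le> K - 1 \<and> (\<forall>h. graph_test (\<xi> 2) (\<xi> 1) h \<in> H A (K - 1)) \<and>
      (\<forall>l\<ge>1. (\<forall>h. graph_test (\<xi> 2) (\<xi> 1) h \<in> H A l) \<longrightarrow> K - 1 \<le> l)) \<and>
     m + 1 = K \<and>
     coherent_window_extending A (m + 1) (\<xi> 2) (\<xi> 1) \<xi> \<and>
     \<not> (\<exists>\<zeta>. coherent_window_extending A (m + 2) (\<xi> 2) (\<xi> 1) \<zeta>)"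
proof -
  have tests: "graph_test (\<xi> 2) (\<xi> 1) h \<in> H A (K - 1)" for h
    unfolding assms(4) using assms(1-3) by (rule graph_test_canonical_mem_H)
  have least: "K - 1 \<le> l" if "\<forall>h. graph_test (\<xi> 2) (\<xi> 1) h \<in> H A l" for l
  proof (rule ccontr)
    assume "\<not> K - 1 \<le> l"
    then have "l < K - 1" by simp
    with assms(1,3) have "graph_test (\<xi> 2) (\<xi> 1) (\<lambda>_. 0) \<notin> H A l"
      unfolding assms(4) by (rule zero_graph_test_notin_H)
    then show False using that by blast
  qed
  have window: "coherent_window_extending A K (\<xi> 2) (\<xi> 1) \<xi>"
    unfolding assms(4) using assms(1-3) by (rule canonical_fragment_coherent)
  have depth: "essential_depth A (\<xi> 2) = enat (K - 1)"
    unfolding assms(4) using assms(1,2) by (rule essential_depth_canonical)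
  have no_longer: "\<not> coherent_window_extending A (K + 1) (\<xi> 2) (\<xi> 1) \<zeta>" for \<zeta>
    unfolding assms(4) using assms(1,2) by (rule no_longer_coherent_window)
  have "m + 1 = K" "m + 2 = K + 1" "1 \<le> K - 1" using assms(2,5) by simp_all
  then show ?thesis using tests least window depth no_longer by simp
qed

end
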